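(* Let $S$ be a semigroup with exponent $n$ such that $\mathcal{M}$ is finite. Then $$|I_2|+|J_2|\le\alpha(\Gamma(S))\le|J_2|+\sum_{a\in\mathcal{M}}\left\lfloor\frac{m_a}{2}\right\rfloor.$$
   Context: For a subset $X$ of a semigroup $S$, $\langle X\rangle$ denotes the subsemigroup generated by $X$; a semigroup is monogenic if it equals $\langle a\rangle=\{a^k : k\in\mathbb{N}\}$ for some element $a$, where $\mathbb{N}=\{1,2,\dots\}$. The cyclic graph $\Gamma(S)$ is the simple undirected graph with vertex set $S$ in which two distinct vertices $x,y$ are adjacent if and only if $\langle x,y\rangle$ is a monogenic subsemigroup of $S$; $\alpha$ denotes the independence number. $S$ is of bounded exponent if there is a positive integer $n$ such that $x^n$ is idempotent for every $x\in S$; the least such $n$ is the exponent of $S$. For an element $a$ with $\langle a\rangle$ finite, its index $m_a$ is the least $m\in\mathbb{N}$ such that $a^m=a^y$ for some $y\in\mathbb{N}$, $y\ne m$. $\mathcal{M}$ is the set of all $a\in S$ such that $\langle a\rangle$ is a maximal monogenic subsemigroup of $S$ (a monogenic subsemigroup not properly contained in any other monogenic subsemigroup of $S$). $\overline{\mathcal{M}}$ is the set of all $a\in S$ such that $\langle a\rangle$ is a maximal cyclic subgroup of $S$ (a subsemigroup that is a cyclic group under the multiplication of $S$ and is not properly contained in any other cyclic subgroup of $S$). Let $\tau$ be the equivalence relation on $S$ given by $x\,\tau\,y$ iff $\langle x\rangle=\langle y\rangle$, and let $X$ be a complete set of distinct representatives of the $\tau$-classes. Put $I_2=\{x\in S :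 m_x=2\}$ and $J_2=\{a\in\overline{\mathcal{M}}\cap X : a\notin\langle x\rangle \text{ for any } x\in I_2\}$. *)

theory Defs
  imports "HOL-Algebra.Elementary_Groups" "HOL-Library.Extended_Nat"
begin

text \<open>A semigroup is a type of class \<^class>\<open>semigroup_mult\<close>; its underlying set is \<^const>\<open>UNIV\<close>.\<close>

section \<open>Powers, subsemigroups, exponent, index\<close>

text \<open>Class \<^class>\<open>semigroup_mult\<close> has no unit, so \<open>x ^ k\<close> is not available. Only exponents
  \<open>k \<ge> 1\<close> are meaningful; the value at \<open>0\<close> is a dummy (and is set to \<open>x\<close>).\<close>

primrec spow :: "'a::semigroup_mult \<Rightarrow> nat \<Rightarrow> 'a" where
  "spow x 0 = x"
| "spow x (Suc k) = (if k = 0 then x else spow x k * x)"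

definition subsemigroup :: "'a::semigroup_mult set \<Rightarrow> bool" where
  "subsemigroup T \<longleftrightarrow> (\<forall>x\<in>T. \<forall>y\<in>T. x * y \<in> T)"

definition sgen :: "'a::semigroup_mult set \<Rightarrow> 'a set" where
  "sgen X = subsemigroup hull X"

definition monogenic :: "'a::semigroup_mult set \<Rightarrow> bool" where
  "monogenic T \<longleftrightarrow> (\<exists>a. T = sgen {a})"

definition idempotent :: "'a::semigroup_mult \<Rightarrow> bool" where
  "idempotent x \<longleftrightarrow> x * x = x"

definition bounded_exponent :: "'a::semigroup_mult itself \<Rightarrow> bool" where
  "bounded_exponent _ \<longleftrightarrow> (\<exists>n\<ge>1. \<forall>x::'a. idempotent (spow x n))"

definition sexponent :: "'a::semigroup_mult itself \<Rightarrow> nat" where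
  "sexponent _ = (LEAST n. n \<ge> 1 \<and> (\<forall>x::'a. idempotent (spow x n)))"

text \<open>The index of \<open>a\<close> is meaningful only if \<^term>\<open>sgen {a}\<close> is finite, which is always the case
  in a semigroup of bounded exponent.\<close>

definition sindex :: "'a::semigroup_mult \<Rightarrow> nat" where
  "sindex a = (LEAST m. m \<ge> 1 \<and> (\<exists>y\<ge>1. y \<noteq> m \<and> spow a m = spow a y))"


section \<open>The cyclic graph and the independence number\<close>

text \<open>A simple graph is given by a vertex set \<open>V\<close> and a symmetric irreflexive edge relation
  \<open>E\<close>.\<close>

definition cyclic_graph :: "('a::semigroup_mult \<times> 'a) set" where
  "cyclic_graph = {(x, y). x \<noteq> y \<and> monogenic (sgen {x, y})}"

definition independent_set :: "'a set \<Rightarrow> ('a \<times> 'a) set \<Rightarrow> 'a set \<Rightarrow> bool" where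
  "independent_set V E A \<longleftrightarrow> A \<subseteq> V \<and> (\<forall>x\<in>A. \<forall>y\<in>A. (x, y) \<notin> E)"

text \<open>Cardinalities are taken in \<^typ>\<open>enat\<close>, because \<^const>\<open>card\<close> is \<open>0\<close> on infinite sets.\<close>

definition ecard :: "'a set \<Rightarrow> enat" where
  "ecard A = (if finite A then enat (card A) else \<infinity>)"

definition independence_number :: "'a set \<Rightarrow> ('a \<times> 'a) set \<Rightarrow> enat" where
  "independence_number V E = (SUP A \<in> {A. independent_set V E A}. ecard A)"


section \<open>Maximal monogenic subsemigroups and maximal cyclic subgroups\<close>

definition maximal_monogenic :: "'a::semigroup_mult set \<Rightarrow> bool" where
  "maximal_monogenic T \<longleftrightarrow> monogenic T \<and> (\<forall>U. monogenic U \<longrightarrow> \<not> T \<subset> U)"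

text \<open>The identity \<open>e\<close> of a subgroup of \<open>S\<close> is an arbitrary idempotent of \<open>S\<close>. Closure under
  the multiplication is part of \<^const>\<open>group\<close>.\<close>

definition cyclic_subgroup :: "'a::semigroup_mult set \<Rightarrow> bool" where
  "cyclic_subgroup H \<longleftrightarrow>
     (\<exists>e. group \<lparr>carrier = H, mult = (*), one = e\<rparr> \<and>
          cyclic_group \<lparr>carrier = H, mult = (*), one = e\<rparr>)"

definition maximal_cyclic_subgroup :: "'a::semigroup_mult set \<Rightarrow> bool" where
  "maximal_cyclic_subgroup H \<longleftrightarrow> cyclic_subgroup H \<and> (\<forall>K. cyclic_subgroup K \<longrightarrow> \<not> H \<subset> K)"

text \<open>The sets \<open>\<M>\<close> and \<open>\<M>\<close>-bar.\<close>

definition M_set :: "'a::semigroup_mult set" where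
  "M_set = {a. maximal_monogenic (sgen {a})}"

definition M_bar :: "'a::semigroup_mult set" where
  "M_bar = {a. maximal_cyclic_subgroup (sgen {a})}"

definition tau :: "('a::semigroup_mult \<times> 'a) set" where
  "tau = {(x, y). sgen {x} = sgen {y}}"

definition representatives :: "('a \<times> 'a) set \<Rightarrow> 'a set \<Rightarrow> bool" where
  "representatives r X \<longleftrightarrow> (\<forall>C \<in> UNIV // r. \<exists>!x. x \<in> X \<inter> C)"

definition I2 :: "'a::semigroup_mult set" where
  "I2 = {x. sindex x = 2}"

definition J2 :: "'a::semigroup_mult set \<Rightarrow> 'a set" where
  "J2 X = {a \<in> M_bar \<inter> X. \<forall>x\<in>I2. a \<notin> sgen {x}}"


section \<open>Basic facts\<close>

lemma spow_1 [simp]: "spow x 1 = x"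
  by simp

lemma spow_eq_power: "k \<ge> 1 \<Longrightarrow> spow x k = x ^ k" for x :: "'a::monoid_mult"
proof (induction k)
  case (Suc k)
  then show ?case by (cases "k = 0") (simp_all add: power_Suc2 del: power_Suc)
qed simp

lemma spow_add: "j \<ge> 1 \<Longrightarrow> k \<ge> 1 \<Longrightarrow> spow x (j + k) = spow x j * spow x k"
proof (induction k)
  case (Suc k)
  then show ?case by (cases "k = 0") (simp_all add: mult.assoc)
qed simp

lemma subsemigroup_sgen: "subsemigroup (sgen X)"
  unfolding sgen_def by (rule hull_in) (auto simp: subsemigroup_def)

lemma sgen_singleton: "sgen {a} = {spow a k | k. k \<ge> 1}"
proof
  have "subsemigroup {spow a k | k. k \<ge> 1}"
    unfolding subsemigroup_def
    by clarify (metis spow_add trans_le_add1)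
  moreover have "a \<in> {spow a k | k. k \<ge> 1}"
    by (metis (mono_tags, lifting) mem_Collect_eq order_refl spow_1)
  ultimately show "sgen {a} \<subseteq> {spow a k | k. k \<ge> 1}"
    unfolding sgen_def by (intro hull_minimal) auto
next
  have a: "a \<in> sgen {a}"
    unfolding sgen_def by (rule hull_inc) simp
  have "spow a k \<in> sgen {a}" for k
    by (induction k) (use a subsemigroup_sgen[of "{a}"] in \<open>auto simp: subsemigroup_def\<close>)
  then show "{spow a k | k. k \<ge> 1} \<subseteq> sgen {a}"
    by blast
qed

lemma sym_cyclic_graph: "sym cyclic_graph" and irrefl_cyclic_graph: "irrefl cyclic_graph"
  by (auto simp: cyclic_graph_def sym_def irrefl_def insert_commute)

lemma equiv_tau: "equiv UNIV tau"
  by (auto simp: tau_def equiv_def refl_on_def sym_def trans_def)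

end

theory Submission
  imports Defs
begin

text \<open>
  Write \<open>m\<close> for the index of \<open>a\<close>. All powers \<open>a\<^sup>i\<close> with \<open>1 \<le> i < m\<close> are distinct from every other
  power of \<open>a\<close>, while the powers with \<open>i \<ge> m\<close> form a group and are exactly the powers of index \<open>1\<close>.
  Two facts about edges of the cyclic graph carry the proof. If \<open>\<langle>x, y\<rangle> = \<langle>c\<rangle>\<close> and \<open>c\<close> does not
  have index \<open>1\<close>, then \<open>c\<close> is \<open>x\<close> or \<open>y\<close>, because such a \<open>c\<close> is not a product of higher powers of
  itself (\<open>monogenic_pair_generator\<close>). Conversely, \<open>\<langle>x, y\<rangle>\<close> is monogenic as soon as one of the two
  elements is a power of the other, or both have index \<open>1\<close> and are powers of a common element
  (\<open>monogenic_pair_index_1\<close>; this is Bezout's identity in the exponents).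

  For the lower bound, \<open>I\<^sub>2 \<union> J\<^sub>2\<close> is independent. By the first fact, an edge at an element of index \<open>2\<close>
  makes one of its ends a power of the other. But the proper powers of an element of \<open>I\<^sub>2\<close> have index
  \<open>1\<close> and \<open>J\<^sub>2\<close> avoids them, and the powers of an element of \<open>J\<^sub>2\<close> have index \<open>1\<close>. Two adjacent elements of \<open>J\<^sub>2\<close> are powers of a
  common \<open>c\<close>, and the powers of \<open>c\<close> contain at most one maximal cyclic subgroup.

  For the upper bound, the elements of an independent set \<open>A\<close> are charged injectively to the
  disjoint union of \<open>J\<^sub>2\<close> and the set of pairs \<open>(a, t)\<close> with \<open>a \<in> \<M>\<close> and \<open>t\<close> odd below the index
  \<open>m\<close> of \<open>a\<close>; there are \<open>\<lfloor>m/2\<rfloor>\<close> such \<open>t\<close>.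
  An element whose index is not \<open>1\<close> is a power \<open>a\<^sup>i\<close> with \<open>a \<in> \<M>\<close> and \<open>i < m\<close>, and is charged to
  the odd part \<open>t\<close> of \<open>i\<close>; among the numbers \<open>i\<close> with the same odd part one always divides the
  other, as in the classical bound for antichains of the divisibility order.
  An element \<open>x\<close> of index \<open>1\<close> lies in a maximal cyclic subgroup, with representative \<open>k \<in> X\<close>. If
  \<open>k \<in> J\<^sub>2\<close>, charge \<open>x\<close> to \<open>k\<close>. Otherwise \<open>k\<close>, hence \<open>x\<close>, is a power of some \<open>a\<^sup>i\<close> of index \<open>2\<close>, and
  \<open>x\<close> is charged to the odd part \<open>t\<close> of \<open>i\<close>. Index \<open>2\<close> forces \<open>m \<le> 2i\<close>, so \<open>i\<close> is the largest number
  below \<open>m\<close> with odd part \<open>t\<close>; every \<open>a\<^sup>j\<close> that competes for \<open>(a, t)\<close> then has \<open>j\<close> dividing \<open>i\<close>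
  and has \<open>x\<close> among its powers, so it is adjacent to \<open>x\<close>.
\<close>

section \<open>Powers, generated subsemigroups and the index\<close>

lemma spow_mult: "1 \<le> i \<Longrightarrow> 1 \<le> j \<Longrightarrow> spow (spow a i) j = spow a (i * j)"
proof (induction j)
  case (Suc j)
  show ?case
  proof (cases "j = 0")
    case False
    then have "spow (spow a i) (Suc j) = spow a (i * j) * spow a i"
      using Suc by simp
    also have "\<dots> = spow a (i * j + i)"
      using Suc.prems False by (subst spow_add) auto
    finally show ?thesis by (simp add: add.commute)
  qed simp
qed simp

lemma mem_sgen_singleton: "y \<in> sgen {a} \<longleftrightarrow> (\<exists>k\<ge>1. y = spow a k)"
  by (auto simp: sgen_singleton)

lemma generator_in_sgen: "a \<in> sgen {a}"
  unfolding mem_sgen_singleton by (rule exI[of _ 1]) simp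

lemma sgen_subset_iff: "subsemigroup T \<Longrightarrow> sgen X \<subseteq> T \<longleftrightarrow> X \<subseteq> T"
  unfolding sgen_def by (meson hull_minimal hull_subset subset_trans)

lemma sgen_singleton_subset_iff: "sgen {x} \<subseteq> sgen {a} \<longleftrightarrow> x \<in> sgen {a}"
  by (simp add: sgen_subset_iff subsemigroup_sgen)

lemma spow_in_sgen: "1 \<le> k \<Longrightarrow> x \<in> sgen Y \<Longrightarrow> spow x k \<in> sgen Y"
  using sgen_subset_iff[OF subsemigroup_sgen, of "{x}" Y] mem_sgen_singleton[of "spow x k" x]
  by blast

lemma monogenic_pair_power:
  assumes "y \<in> sgen {x}"
  shows "monogenic (sgen {x, y})"
proof -
  have "sgen {x, y} = sgen {x}"
  proof
    show "sgen {x, y} \<subseteq> sgen {x}"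
      using assms generator_in_sgen by (simp add: sgen_subset_iff subsemigroup_sgen)
    show "sgen {x} \<subseteq> sgen {x, y}"
      by (metis sgen_subset_iff subsemigroup_sgen sgen_def hull_subset insert_subset empty_subsetI)
  qed
  then show ?thesis by (auto simp: monogenic_def)
qed

lemma sindex_le:
  assumes "1 \<le> p" "1 \<le> y" "p \<noteq> y" "spow a p = spow a y"
  shows "sindex a \<le> p"
  unfolding sindex_def using assms by (intro Least_le) auto

text \<open>The type argument ties the exponent to one semigroup, which no other parameter determines.\<close>

locale periodic_semigroup =
  fixes n :: nat and S :: "'a::semigroup_mult itself"
  assumes exponent_pos: "1 \<le> n"
    and power_idempotent: "\<And>x::'a. idempotent (spow x n)"
begin

lemma spow_multiple_exponent: "1 \<le> t \<Longrightarrow> spow (a::'a) (n * t) = spow a n"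
proof (induction t)
  case (Suc t)
  show ?case
  proof (cases "t = 0")
    case False
    have "spow a (n * Suc t) = spow a (n * t + n)" by (simp add: add.commute)
    also have "\<dots> = spow a (n * t) * spow a n"
      using exponent_pos False by (intro spow_add) auto
    finally show ?thesis
      using Suc False power_idempotent[of a] by (simp add: idempotent_def)
  qed simp
qed simp

lemma spow_add_multiple_exponent:
  assumes "1 \<le> d" "1 \<le> t"
  shows "spow (a::'a) (d + n * t) = spow a (d + n)"
  using assms exponent_pos spow_multiple_exponent[of t a]
  by (simp add: spow_add)

lemma sindex_repeats:
  "1 \<le> sindex (a::'a) \<and> (\<exists>y > sindex a. spow a (sindex a) = spow a y)"
proof -
  have "spow a n = spow a (n * 2)" using spow_multiple_exponent[of 2 a] by simp
  then have "n \<ge> 1 \<and> (\<exists>y\<ge>1. y \<noteq> n \<and> spow a n = spow a y)"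
    using exponent_pos by (intro conjI exI[of _ "n * 2"]) auto
  then have *: "sindex a \<ge> 1 \<and> (\<exists>y\<ge>1. y \<noteq> sindex a \<and> spow a (sindex a) = spow a y)"
    unfolding sindex_def by (rule LeastI)
  then obtain y where y: "y \<ge> 1" "y \<noteq> sindex a" "spow a (sindex a) = spow a y" by blast
  then have "sindex a \<le> y" using * by (intro sindex_le[of y "sindex a"]) auto
  with y * show ?thesis by (metis le_neq_implies_less)
qed

lemma sindex_eq_1_iff: "sindex (a::'a) = 1 \<longleftrightarrow> spow a (1 + n) = a"
proof
  assume "sindex a = 1"
  then obtain y where y: "y > 1" "spow a 1 = spow a y" using sindex_repeats[of a] by auto
  define p where "p = y - 1"
  have p: "p \<ge> 1" "spow a (1 + p) = a" using y by (auto simp: p_def)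
  have "spow a (1 + t * p) = a" for t
  proof (induction t)
    case (Suc t)
    have "spow a (1 + Suc t * p) = spow a ((1 + t * p) + p)" by (simp add: algebra_simps)
    also have "\<dots> = spow a (1 + t * p) * spow a p" using p by (intro spow_add) auto
    also have "\<dots> = spow a 1 * spow a p" using Suc by simp
    also have "\<dots> = spow a (1 + p)" using p by (intro spow_add[symmetric]) auto
    finally show ?case using p by simp
  qed simp
  from this[of n] show "spow a (1 + n) = a"
    using spow_add_multiple_exponent[of 1 p a] p by (simp del: spow.simps)
next
  assume "spow a (1 + n) = a"
  then have "spow a 1 = spow a (1 + n)" by simp
  then have "sindex a \<le> 1" using exponent_pos by (intro sindex_le[of 1 "1 + n"]) auto
  then show "sindex a = 1" using sindex_repeats[of a] by linarith
qed

text \<open>From the index on, the powers of \<open>a\<close> have some period \<open>p\<close>. Multiplying \<open>a\<^sup>i\<close> by its own \<open>n\<close>-th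
  power adds \<open>n * i\<close> to the exponent, which has the same effect as adding \<open>n * p\<close>, that is, none.\<close>

lemma sindex_spow_eq_1:
  assumes "sindex (a::'a) \<le> i"
  shows "sindex (spow a i) = 1"
proof -
  have m: "1 \<le> sindex a" using sindex_repeats[of a] by blast
  obtain y where y: "y > sindex a" "spow a (sindex a) = spow a y"
    using sindex_repeats[of a] by blast
  define p where "p = y - sindex a"
  have p: "p \<ge> 1" "spow a (sindex a + p) = spow a (sindex a)" using y by (auto simp: p_def)
  have step: "spow a (j + p) = spow a j" if "sindex a \<le> j" for j
  proof (cases "j = sindex a")
    case False
    then have j: "j - sindex a \<ge> 1" using that by simp
    have "spow a (j + p) = spow a ((sindex a + p) + (j - sindex a))"
      using that by (simp add: add.commute)
    also have "\<dots> = spow a (sindex a + p) * spow a (j - sindex a)"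
      using j m p by (intro spow_add) auto
    also have "\<dots> = spow a (sindex a + (j - sindex a))"
      using j m by (subst spow_add) (auto simp: p(2))
    finally show ?thesis using that by simp
  qed (use p in simp)
  have iter: "spow a (i + t * p) = spow a i" for t
  proof (induction t)
    case (Suc t)
    have "spow a (i + Suc t * p) = spow a ((i + t * p) + p)" by (simp add: algebra_simps)
    then show ?case using step[of "i + t * p"] Suc assms by simp
  qed simp
  have i: "1 \<le> i" using assms m by simp
  have "spow (spow a i) (1 + n) = spow a (i + n * i)"
    using i by (subst spow_mult) (auto simp: algebra_simps)
  also have "\<dots> = spow a (i + n * p)"
    using i p spow_add_multiple_exponent[of i] by metis
  also have "\<dots> = spow a i" by (rule iter)
  finally show ?thesis by (simp only: sindex_eq_1_iff)
qed

lemma sindex_eq_1_spow: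
  assumes "sindex (a::'a) = 1" "1 \<le> i"
  shows "sindex (spow a i) = 1"
  using assms by (intro sindex_spow_eq_1) simp

lemma sindex_le_twice:
  assumes "sindex (spow (a::'a) i) = 2" "1 \<le> i"
  shows "sindex a \<le> 2 * i"
proof -
  obtain y where y: "y > 2" "spow (spow a i) 2 = spow (spow a i) y"
    using sindex_repeats[of "spow a i"] assms by auto
  then have "spow a (i * 2) = spow a (i * y)" 
    using assms spow_mult[of i 2 a] spow_mult[of i y a] by simp
  then have "sindex a \<le> i * 2" using y assms by (intro sindex_le[of "i * 2" "i * y"]) auto
  then show ?thesis by simp
qed

section \<open>Pairs that generate a monogenic subsemigroup\<close>

lemma monogenic_pair_generator:
  assumes gen: "sgen {x, y} = sgen {c::'a}" and "sindex c \<noteq> 1"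
  shows "c = x \<or> c = y"
proof (rule ccontr)
  assume neq: "\<not> (c = x \<or> c = y)"
  let ?T = "{spow c k | k. 2 \<le> k}"
  have "x \<in> sgen {c}" "y \<in> sgen {c}"
    unfolding gen[symmetric] by (auto simp: sgen_def intro: hull_inc)
  then obtain i j where ij: "i \<ge> 1" "x = spow c i" "j \<ge> 1" "y = spow c j"
    unfolding mem_sgen_singleton by blast
  have "i \<noteq> 1" "j \<noteq> 1" using neq ij by auto
  then have "2 \<le> i" "2 \<le> j" using ij by linarith+
  then have xy: "{x, y} \<subseteq> ?T" using ij by blast
  have T: "subsemigroup ?T"
    unfolding subsemigroup_def
  proof clarify
    fix k l :: nat assume kl: "2 \<le> k" "2 \<le> l"
    then have "spow c k * spow c l = spow c (k + l)" by (simp add: spow_add)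
    then show "\<exists>k'. spow c k * spow c l = spow c k' \<and> 2 \<le> k'" using kl by force
  qed
  have "c \<in> ?T"
    using sgen_subset_iff[OF T, of "{x, y}"] xy generator_in_sgen[of c] gen by blast
  then obtain k where "2 \<le> k" "c = spow c k" by blast
  then have "sindex c \<le> 1" by (intro sindex_le[of 1 k]) auto
  then show False using assms(2) sindex_repeats[of c] by linarith
qed

lemma edge_generator_cases:
  assumes "monogenic (sgen {x, y::'a})" and "sindex x \<noteq> 1"
  shows "y \<in> sgen {x} \<or> x \<in> sgen {y}"
proof -
  obtain c where c: "sgen {x, y} = sgen {c}" using assms by (auto simp: monogenic_def)
  then have mem: "x \<in> sgen {c}" "y \<in> sgen {c}"
    unfolding c[symmetric] by (auto simp: sgen_def intro: hull_inc)
  then have "sindex c \<noteq> 1"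
    using assms(2) sindex_eq_1_spow unfolding mem_sgen_singleton by blast
  then show ?thesis using monogenic_pair_generator[OF c] mem by blast
qed

text \<open>In the group formed by the powers of index \<open>1\<close>, the elements \<open>a\<^sup>i\<close> and \<open>a\<^sup>j\<close> generate the same
  subgroup as \<open>a\<^sup>d\<close> times the identity, where \<open>d = gcd i j\<close>. The identity is \<open>a\<^sup>n\<close>, and all exponents
  are kept positive by adding multiples of \<open>n\<close>.\<close>

lemma monogenic_pair_index_1:
  assumes "x \<in> sgen {a::'a}" "y \<in> sgen {a}" "sindex x = 1" "sindex y = 1"
  shows "monogenic (sgen {x, y})"
proof -
  obtain i j where ij: "i \<ge> 1" "x = spow a i" "j \<ge> 1" "y = spow a j"
    using assms unfolding mem_sgen_singleton by blast
  define d where "d = gcd i j"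
  have d: "d \<ge> 1" "d dvd i" "d dvd j" using ij by (auto simp: d_def Suc_le_eq)
  define c where "c = spow a (d + n)"
  have mult_in: "spow a k \<in> sgen {c}" if k: "d dvd k" "1 \<le> k" "sindex (spow a k) = 1" for k
  proof -
    obtain q where q: "k = d * q" using k by blast
    then have q1: "1 \<le> q" using k by (cases q) auto
    have "spow c q = spow a ((d + n) * q)" unfolding c_def using d q1 by (intro spow_mult) auto
    also have "\<dots> = spow a (k + n * q)" by (simp add: q algebra_simps)
    also have "\<dots> = spow a (k + n * k)"
      using spow_add_multiple_exponent k q1 by simp
    also have "\<dots> = spow (spow a k) (1 + n)"
      using k by (subst spow_mult) (auto simp: algebra_simps)
    also have "\<dots> = spow a k" using k by (simp only: sindex_eq_1_iff)
    finally show ?thesis using q1 unfolding mem_sgen_singleton by metis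
  qed
  obtain u v where uv: "i * u = j * v + d"
    using bezout_nat[of i j] ij by (auto simp: d_def)
  let ?p = "u + n" and ?q = "v * (n - 1) + n"
  have "i * ?p + j * ?q = d + n * (j * v + i + j)"
  proof -
    have "j * v + j * (v * (n - 1)) = n * (j * v)"
      using exponent_pos by (cases n) (auto simp: algebra_simps)
    with uv show ?thesis by (simp add: algebra_simps)
  qed
  then have "spow x ?p * spow y ?q = spow a (d + n * (j * v + i + j))"
    using ij exponent_pos by (simp add: spow_mult flip: spow_add)
  also have "\<dots> = c"
    unfolding c_def using d ij by (intro spow_add_multiple_exponent) auto
  finally have c_eq: "c = spow x ?p * spow y ?q" by simp
  have "{x, y} \<subseteq> sgen {x, y}" by (simp add: sgen_def hull_subset)
  then have "spow x ?p \<in> sgen {x, y}" "spow y ?q \<in> sgen {x, y}"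
    using exponent_pos by (auto intro!: spow_in_sgen)
  then have "c \<in> sgen {x, y}"
    unfolding c_eq using subsemigroup_sgen[of "{x, y}"] by (simp add: subsemigroup_def)
  then have "sgen {c} \<subseteq> sgen {x, y}" by (simp add: sgen_subset_iff subsemigroup_sgen)
  moreover have "sgen {x, y} \<subseteq> sgen {c}"
    using mult_in[of i] mult_in[of j] d ij assms
    by (simp add: sgen_subset_iff subsemigroup_sgen)
  ultimately show ?thesis by (auto simp: monogenic_def)
qed

section \<open>Maximal monogenic subsemigroups and maximal cyclic subgroups\<close>

text \<open>The \<open>n\<close>-th power of an element of a subgroup is an idempotent of the group, hence its identity.
  So integer powers reduce to positive ones, and cyclic groups are monogenic.\<close>

lemma cyclic_subgroup_iff: "cyclic_subgroup H \<longleftrightarrow> (\<exists>g::'a. sindex g = 1 \<and> H = sgen {g})"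
proof
  assume "cyclic_subgroup H"
  then obtain e where e: "group \<lparr>carrier = H, mult = (*), one = e\<rparr>"
      "cyclic_group \<lparr>carrier = H, mult = (*), one = e\<rparr>"
    by (auto simp: cyclic_subgroup_def)
  define G where "G = \<lparr>carrier = H, mult = (*), one = e\<rparr>"
  interpret group G using e by (simp add: G_def)
  obtain g where g: "g \<in> carrier G" "carrier G = range (\<lambda>k::int. g [^]\<^bsub>G\<^esub> k)"
    using e(2) cyclic_group by (auto simp: G_def)
  have pow: "spow g k = g [^]\<^bsub>G\<^esub> k" if "k \<ge> 1" for k :: nat
    using that
  proof (induction k)
    case (Suc k)
    then show ?case using l_one[OF g(1)] by (cases "k = 0") (auto simp: G_def)
  qed simp
  have "spow g n * spow g n = spow g n" using power_idempotent[of g] by (simp add: idempotent_def)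
  then have "g [^]\<^bsub>G\<^esub> n \<otimes>\<^bsub>G\<^esub> g [^]\<^bsub>G\<^esub> n = g [^]\<^bsub>G\<^esub> n"
    using pow[OF exponent_pos] by (simp add: G_def)
  then have gn: "g [^]\<^bsub>G\<^esub> n = \<one>\<^bsub>G\<^esub>" using g(1) by simp
  have "spow g (1 + n) = g"
    using pow[of "1 + n"] gn g(1) by (simp del: spow.simps)
  then have "sindex g = 1" by (simp only: sindex_eq_1_iff)
  moreover have "H = sgen {g}"
  proof
    show "H \<subseteq> sgen {g}"
    proof
      fix h assume "h \<in> H"
      then obtain z :: int where z: "h = g [^]\<^bsub>G\<^esub> z" using g(2) by (auto simp: G_def)
      define k where "k = nat (z mod int n) + n"
      have "int k = z + int n * (1 - z div int n)"
        using exponent_pos pos_mod_sign[of "int n" z]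
        by (simp add: k_def algebra_simps minus_mult_div_eq_mod [symmetric])
      then have "g [^]\<^bsub>G\<^esub> int k = g [^]\<^bsub>G\<^esub> z \<otimes>\<^bsub>G\<^esub> (g [^]\<^bsub>G\<^esub> int n) [^]\<^bsub>G\<^esub> (1 - z div int n)"
        using g(1) by (simp add: int_pow_mult int_pow_pow)
      moreover have "g [^]\<^bsub>G\<^esub> int n = \<one>\<^bsub>G\<^esub>" using gn by (simp add: int_pow_int)
      ultimately have "g [^]\<^bsub>G\<^esub> int k = h" using z g(1) by simp
      then have "h = g [^]\<^bsub>G\<^esub> k" by (simp only: int_pow_int)
      moreover have "1 \<le> k" using exponent_pos by (simp add: k_def)
      ultimately show "h \<in> sgen {g}" unfolding mem_sgen_singleton using pow by metis
    qed
    show "sgen {g} \<subseteq> H"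
    proof
      fix h assume "h \<in> sgen {g}"
      then obtain k :: nat where "k \<ge> 1" "h = g [^]\<^bsub>G\<^esub> k" using pow by (auto simp: mem_sgen_singleton)
      then show "h \<in> H" using nat_pow_closed[OF g(1)] by (simp add: G_def)
    qed
  qed
  ultimately show "\<exists>g. sindex g = 1 \<and> H = sgen {g}" by blast
next
  assume "\<exists>g. sindex g = 1 \<and> H = sgen {g}"
  then obtain g where g: "spow g (1 + n) = g" and H: "H = sgen {g}"
    by (auto simp only: sindex_eq_1_iff)
  define e where "e = spow g n"
  define G where "G = \<lparr>carrier = H, mult = (*), one = e\<rparr>"
  have unit: "e * h = h" if h: "h \<in> H" for h
  proof -
    obtain k where k: "k \<ge> 1" "h = spow g k"
      using h unfolding H mem_sgen_singleton by blast
    have "e * h = spow g (k + n * k)"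
      unfolding e_def k(2) using k exponent_pos spow_add_multiple_exponent[of k k g]
      by (simp add: add.commute flip: spow_add)
    also have "\<dots> = spow (spow g (1 + n)) k"
      using k exponent_pos by (subst spow_mult) (auto simp: algebra_simps)
    finally show ?thesis using g k by simp
  qed
  have "group G"
  proof (rule groupI)
    show "x \<otimes>\<^bsub>G\<^esub> y \<in> carrier G" if "x \<in> carrier G" "y \<in> carrier G" for x y
      using that subsemigroup_sgen[of "{g}"] by (simp add: G_def H subsemigroup_def)
    show "\<one>\<^bsub>G\<^esub> \<in> carrier G"
      using exponent_pos by (auto simp: G_def H e_def mem_sgen_singleton)
    show "x \<otimes>\<^bsub>G\<^esub> y \<otimes>\<^bsub>G\<^esub> z = x \<otimes>\<^bsub>G\<^esub> (y \<otimes>\<^bsub>G\<^esub> z)" for x y z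
      by (simp add: G_def mult.assoc)
    show "\<one>\<^bsub>G\<^esub> \<otimes>\<^bsub>G\<^esub> x = x" if "x \<in> carrier G" for x
      using that unit by (simp add: G_def)
    show "\<exists>y\<in>carrier G. y \<otimes>\<^bsub>G\<^esub> x = \<one>\<^bsub>G\<^esub>" if x: "x \<in> carrier G" for x
    proof -
      obtain k where k: "k \<ge> 1" "x = spow g k" using x by (auto simp: G_def H mem_sgen_singleton)
      \<comment> \<open>The exponent \<open>k * (n - 1)\<close> would do, except that it is \<open>0\<close> for \<open>n = 1\<close>.\<close>
      let ?y = "spow g (k * (2 * n - 1))"
      have "?y * x = spow g (k * (2 * n - 1) + k)"
        unfolding k(2) using k exponent_pos by (intro spow_add[symmetric]) auto
      also have "k * (2 * n - 1) + k = n * (2 * k)"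
        using exponent_pos by (cases n) (auto simp: algebra_simps)
      also have "spow g (n * (2 * k)) = e"
        unfolding e_def using k by (intro spow_multiple_exponent) auto
      finally have "?y * x = e" .
      moreover have "?y \<in> H"
        unfolding H using k exponent_pos generator_in_sgen by (intro spow_in_sgen) auto
      ultimately show ?thesis by (auto simp: G_def)
    qed
  qed
  then interpret group G .
  have gG: "g \<in> carrier G" by (simp add: G_def H generator_in_sgen)
  have pow: "spow g k = g [^]\<^bsub>G\<^esub> k" if "k \<ge> 1" for k :: nat
    using that
  proof (induction k)
    case (Suc k)
    then show ?case using l_one[OF gG] by (cases "k = 0") (auto simp: G_def)
  qed simp
  have "carrier G = range (\<lambda>k::int. g [^]\<^bsub>G\<^esub> k)"
  proof
    show "carrier G \<subseteq> range (\<lambda>k::int. g [^]\<^bsub>G\<^esub> k)"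
    proof
      fix h assume "h \<in> carrier G"
      then obtain k where "k \<ge> 1" "h = spow g k" by (auto simp: G_def H mem_sgen_singleton)
      then have "h = g [^]\<^bsub>G\<^esub> int k" using pow by (simp add: int_pow_int)
      then show "h \<in> range (\<lambda>k::int. g [^]\<^bsub>G\<^esub> k)" by blast
    qed
  qed (use gG in auto)
  then have "cyclic_group G" using cyclic_group gG by blast
  with \<open>group G\<close> show "cyclic_subgroup H" unfolding cyclic_subgroup_def G_def by blast
qed

text \<open>Ascending chains of monogenic subsemigroups stabilise because their sizes are bounded.\<close>

lemma card_sgen_le: "finite (sgen {a::'a}) \<and> card (sgen {a}) \<le> 2 * n"
proof -
  have sub: "sgen {a} \<subseteq> spow a ` {..<2 * n}"
  proof
    fix x assume "x \<in> sgen {a}"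
    then obtain k where k: "k \<ge> 1" "x = spow a k" by (auto simp: mem_sgen_singleton)
    show "x \<in> spow a ` {..<2 * n}"
    proof (cases "k < 2 * n")
      case False
      let ?d = "k mod n" and ?t = "k div n"
      have t: "1 \<le> ?t" using False exponent_pos by (simp add: div_greater_zero_iff Suc_le_eq)
      have "?d + n < 2 * n" using exponent_pos by simp
      moreover have "spow a k = spow a (?d + n)"
      proof (cases "?d = 0")
        case True
        then have "k = n * ?t" using mult_div_mod_eq[of n k] by simp
        then show ?thesis using True spow_multiple_exponent[OF t, of a] by simp
      next
        case False
        then show ?thesis using spow_add_multiple_exponent[of ?d ?t a] t by simp
      qed
      ultimately show ?thesis using k by auto
    qed (use k in auto)
  qed
  then have "finite (sgen {a})" by (rule finite_subset) simp
  moreover have "card (sgen {a}) \<le> 2 * n"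
    using card_mono[OF _ sub] card_image_le[of "{..<2 * n}" "spow a"] by simp
  ultimately show ?thesis by simp
qed

lemma exists_maximal_sgen:
  assumes "P (x::'a)"
  shows "\<exists>y. P y \<and> x \<in> sgen {y} \<and> (\<forall>z. P z \<longrightarrow> \<not> sgen {y} \<subset> sgen {z})"
proof -
  have "P x \<and> x \<in> sgen {x}" using assms generator_in_sgen by blast
  moreover have "\<forall>y. P y \<and> x \<in> sgen {y} \<longrightarrow> card (sgen {y}) < Suc (2 * n)"
    using card_sgen_le by (simp add: less_Suc_eq_le)
  ultimately obtain y where y: "P y" "x \<in> sgen {y}"
      "\<And>z. P z \<and> x \<in> sgen {z} \<Longrightarrow> card (sgen {z}) \<le> card (sgen {y})"
    using ex_has_greatest_nat[of "\<lambda>y. P y \<and> x \<in> sgen {y}" x "\<lambda>y. card (sgen {y})" "Suc (2 * n)"]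
    by blast
  have "\<not> sgen {y} \<subset> sgen {z}" if "P z" for z
  proof
    assume "sgen {y} \<subset> sgen {z}"
    then have "card (sgen {y}) < card (sgen {z})" "x \<in> sgen {z}"
      using card_sgen_le y by (auto intro: psubset_card_mono)
    then show False using y(3)[of z] that by auto
  qed
  with y show ?thesis by blast
qed

lemma exists_M_set_above: "\<exists>a\<in>M_set. (x::'a) \<in> sgen {a}"
  using exists_maximal_sgen[of "\<lambda>_. True" x]
  by (auto simp: M_set_def maximal_monogenic_def monogenic_def)

lemma exists_M_set_power:
  assumes "sindex (x::'a) \<noteq> 1"
  obtains a i where "a \<in> M_set" "x = spow a i" "1 \<le> i" "i < sindex a"
proof -
  obtain a i where "a \<in> M_set" "1 \<le> i" "x = spow a i"
    using exists_M_set_above[of x] by (auto simp: mem_sgen_singleton)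
  moreover from this have "i < sindex a" using assms sindex_spow_eq_1[of a i] by force
  ultimately show thesis using that by blast
qed

lemma M_bar_iff:
  "(a::'a) \<in> M_bar \<longleftrightarrow> cyclic_subgroup (sgen {a}) \<and> (\<forall>z::'a. sindex z = 1 \<longrightarrow> \<not> sgen {a} \<subset> sgen {z})"
  by (auto simp: M_bar_def maximal_cyclic_subgroup_def cyclic_subgroup_iff)

lemma sindex_M_bar: "(a::'a) \<in> M_bar \<Longrightarrow> sindex a = 1"
proof -
  assume "a \<in> M_bar"
  then obtain g :: 'a where g: "sindex g = 1" "sgen {a} = sgen {g}"
    by (auto simp: M_bar_iff cyclic_subgroup_iff)
  then obtain k where "1 \<le> k" "a = spow g k"
    using generator_in_sgen[of a] by (auto simp: mem_sgen_singleton)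
  then show ?thesis using g sindex_eq_1_spow by blast
qed

lemma exists_representative:
  assumes "representatives tau X"
  shows "\<exists>z\<in>X. sgen {z} = sgen {y::'a}"
proof -
  have "tau `` {y} \<in> UNIV // tau" by (simp add: quotientI)
  then obtain z where "z \<in> X \<inter> tau `` {y}" using assms unfolding representatives_def by blast
  then show ?thesis by (auto simp: tau_def)
qed

lemma representative_unique:
  assumes "representatives tau X" "x \<in> X" "y \<in> X" "sgen {x} = sgen {y::'a}"
  shows "x = y"
proof -
  have "tau `` {y} \<in> UNIV // tau" by (simp add: quotientI)
  then have "\<exists>!z. z \<in> X \<inter> tau `` {y}" using assms(1) unfolding representatives_def by (rule bspec[rotated])
  moreover have "x \<in> X \<inter> tau `` {y}" "y \<in> X \<inter> tau `` {y}" using assms by (auto simp: tau_def)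
  ultimately show ?thesis by (elim ex1E) metis
qed

lemma exists_M_bar_representative:
  assumes "sindex (x::'a) = 1" "representatives tau X"
  shows "\<exists>k \<in> M_bar \<inter> X. x \<in> sgen {k}"
proof -
  obtain y where y: "sindex y = 1" "x \<in> sgen {y}"
      "\<forall>z::'a. sindex z = 1 \<longrightarrow> \<not> sgen {y} \<subset> sgen {z}"
    using exists_maximal_sgen[of "\<lambda>y. sindex y = 1" x] assms by blast
  obtain k where k: "k \<in> X" "sgen {k} = sgen {y}" using exists_representative[OF assms(2)] by blast
  then have "k \<in> M_bar" unfolding M_bar_iff k(2) cyclic_subgroup_iff using y by blast
  then show ?thesis using k y by blast
qed

text \<open>The powers of index \<open>1\<close> of \<open>c\<close> form the single cyclic subgroup generated by \<open>c\<^sup>1\<^sup>+\<^sup>n\<close>. So two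
  generators of maximal cyclic subgroups that are both powers of \<open>c\<close> are \<open>\<tau>\<close>-equivalent.\<close>

lemma M_bar_common_generator:
  assumes "a \<in> M_bar" "a \<in> sgen {c::'a}"
  shows "sgen {a} = sgen {spow c (1 + n)}"
proof -
  let ?g = "spow c (1 + n)"
  have "spow ?g (1 + n) = spow c ((1 + n) + n * (1 + n))"
    by (subst spow_mult) (auto simp: algebra_simps)
  also have "\<dots> = spow c ((1 + n) + n)"
    by (rule spow_add_multiple_exponent) auto
  also have "(1 + n) + n = 1 + n * 2" by simp
  also have "spow c (1 + n * 2) = ?g" by (rule spow_add_multiple_exponent) auto
  finally have g: "sindex ?g = 1" by (simp only: sindex_eq_1_iff)
  obtain i where i: "i \<ge> 1" "a = spow c i" using assms by (auto simp: mem_sgen_singleton)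
  have "a = spow (spow c i) (1 + n)" using sindex_M_bar[OF assms(1)] i sindex_eq_1_iff[of a] by metis
  also have "\<dots> = spow ?g i" using i by (simp add: spow_mult mult.commute del: spow.simps)
  finally have "sgen {a} \<subseteq> sgen {?g}"
    using i unfolding sgen_singleton_subset_iff mem_sgen_singleton by blast
  then show ?thesis using assms(1) g unfolding M_bar_iff by blast
qed

section \<open>The lower bound\<close>

lemma independent_I2_J2:
  assumes "representatives tau X"
  shows "independent_set UNIV cyclic_graph ((I2 :: 'a set) \<union> J2 X)"
proof -
  have J_index: "sindex a = 1" if "a \<in> J2 X" for a :: 'a
    using that sindex_M_bar by (auto simp: J2_def)
  have not_power: "y \<notin> sgen {x}" if xy: "x \<in> I2" "y \<in> I2 \<union> J2 X" "x \<noteq> y" for x y :: 'a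
  proof
    assume mem: "y \<in> sgen {x}"
    then have "y \<in> I2" using xy by (auto simp: J2_def)
    obtain j where j: "1 \<le> j" "y = spow x j" using mem by (auto simp: mem_sgen_singleton)
    then have "j \<noteq> 1" using xy by auto
    then have "sindex x \<le> j" using j xy by (simp add: I2_def)
    then have "sindex y = 1" using j sindex_spow_eq_1 by blast
    then show False using \<open>y \<in> I2\<close> by (simp add: I2_def)
  qed
  have I_edge: False if xy: "x \<in> I2" "y \<in> I2 \<union> J2 X" "x \<noteq> y" "monogenic (sgen {x, y})" for x y :: 'a
  proof -
    have "x \<in> sgen {y}"
      using edge_generator_cases[OF xy(4)] not_power[OF xy(1-3)] xy(1) by (auto simp: I2_def)
    moreover from this have "y \<in> I2"
      using xy J_index[of y] sindex_eq_1_spow by (fastforce simp: I2_def mem_sgen_singleton)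
    ultimately show False using not_power[of y x] xy by auto
  qed
  have J_edge: False if xy: "x \<in> J2 X" "y \<in> J2 X" "x \<noteq> y" "monogenic (sgen {x, y})" for x y :: 'a
  proof -
    obtain c where "sgen {x, y} = sgen {c}" using xy by (auto simp: monogenic_def)
    then have "x \<in> sgen {c}" "y \<in> sgen {c}" by (metis hull_inc insertI1 insertI2 sgen_def)+
    then have "sgen {x} = sgen {y}" using xy M_bar_common_generator[of _ c] by (auto simp: J2_def)
    then show False using representative_unique[OF assms] xy by (auto simp: J2_def)
  qed
  show ?thesis
    unfolding independent_set_def cyclic_graph_def
  proof (intro conjI ballI notI subset_UNIV)
    fix x y :: 'a
    assume "x \<in> I2 \<union> J2 X" "y \<in> I2 \<union> J2 X" "(x, y) \<in> {(x, y). x \<noteq> y \<and> monogenic (sgen {x, y})}"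
    then show False using I_edge[of x y] I_edge[of y x] J_edge[of x y]
      by (auto simp: insert_commute)
  qed
qed

section \<open>The upper bound\<close>

text \<open>In the last case, the bound on the index of \<open>a\<close> says that no number below this index and with
  odd part \<open>t\<close> exceeds \<open>2\<^sup>s * t\<close>.\<close>

fun charged :: "'a \<Rightarrow> 'a + ('a \<times> nat) \<Rightarrow> bool" where
  "charged x (Inl k) \<longleftrightarrow> sindex x = 1 \<and> x \<in> sgen {k}"
| "charged x (Inr (a, t)) \<longleftrightarrow>
     (\<exists>s. x = spow a (2 ^ s * t) \<and> 2 ^ s * t < sindex a)
   \<or> (\<exists>s. sindex x = 1 \<and> x \<in> sgen {spow a (2 ^ s * t)} \<and> sindex a \<le> 2 * (2 ^ s * t))"

definition tokens :: "'a set \<Rightarrow> ('a + ('a \<times> nat)) set" where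
  "tokens X = J2 X <+> (SIGMA a:M_set. {t. odd t \<and> t < sindex a})"

lemma exists_odd_part: "1 \<le> (i::nat) \<Longrightarrow> \<exists>s t. i = 2 ^ s * t \<and> odd t \<and> t \<le> i"
proof (induction i rule: less_induct)
  case (less i)
  show ?case
  proof (cases "odd i")
    case True
    then show ?thesis by (intro exI[of _ 0] exI[of _ i]) simp
  next
    case False
    then obtain j where j: "i = 2 * j" by blast
    then obtain s t where "j = 2 ^ s * t" "odd t" "t \<le> j"
      using less.IH[of j] less.prems by auto
    then show ?thesis using j by (intro exI[of _ "Suc s"] exI[of _ t]) simp
  qed
qed

lemma exists_token:
  assumes "representatives tau X"
  shows "\<exists>z \<in> tokens X. charged (x::'a) z"
proof (cases "sindex x = 1")
  case False
  then obtain a i where a: "a \<in> M_set" "x = spow a i" "1 \<le> i" "i < sindex a"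
    by (rule exists_M_set_power)
  obtain s t where "i = 2 ^ s * t" "odd t" "t \<le> i" using exists_odd_part[OF a(3)] by blast
  moreover from this have "t < sindex a" using a by linarith
  ultimately show ?thesis
    using a by (intro bexI[of _ "Inr (a, t)"]) (auto simp: tokens_def)
next
  case True
  then obtain k where k: "k \<in> M_bar \<inter> X" "x \<in> sgen {k}"
    using exists_M_bar_representative assms by blast
  show ?thesis
  proof (cases "k \<in> J2 X")
    case True
    then show ?thesis
      using k \<open>sindex x = 1\<close> by (intro bexI[of _ "Inl k"]) (auto simp: tokens_def)
  next
    case False
    then obtain y where y: "y \<in> I2" "k \<in> sgen {y}" using k by (auto simp: J2_def)
    then have y2: "sindex y = 2" by (simp add: I2_def)
    then have "sindex y \<noteq> 1" by simp
    then obtain a i where a: "a \<in> M_set" "y = spow a i" "1 \<le> i" "i < sindex a"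
      by (rule exists_M_set_power)
    obtain s t where t: "i = 2 ^ s * t" "odd t" "t \<le> i" using exists_odd_part[OF a(3)] by blast
    have "t < sindex a" using a t by linarith
    then have "Inr (a, t) \<in> tokens X" using a(1) t(2) by (auto simp: tokens_def)
    have "sindex a \<le> 2 * i" using sindex_le_twice y2 a by blast
    moreover have "x \<in> sgen {y}" using k y sgen_singleton_subset_iff by blast
    ultimately have "charged x (Inr (a, t))" using \<open>sindex x = 1\<close> a t by auto
    with \<open>Inr (a, t) \<in> tokens X\<close> show ?thesis by blast
  qed
qed

text \<open>The exponents \<open>2\<^sup>s * t\<close> with fixed \<open>t\<close> form a chain for divisibility, so of two powers of \<open>a\<close> with
  such exponents one is a power of the other.\<close>

lemma same_token_adjacent:
  assumes "z \<in> tokens X" "charged x z" "charged (y::'a) z"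
  shows "monogenic (sgen {x, y})"
proof (cases z)
  case (Inl k)
  then show ?thesis using assms monogenic_pair_index_1[of x k y] by simp
next
  case (Inr p)
  then obtain a t where z: "z = Inr (a, t)" by (cases p) auto
  then have "odd t" using assms by (auto simp: tokens_def)
  then have t: "t \<ge> 1" by (cases t) auto
  have pos: "1 \<le> 2 ^ s * t" for s :: nat using t by simp
  have in_a: "sgen {spow a (2 ^ s * t)} \<subseteq> sgen {a}" for s
    unfolding sgen_singleton_subset_iff mem_sgen_singleton using pos by blast
  have power: "spow a (2 ^ s' * t) \<in> sgen {spow a (2 ^ s * t)}" if "s \<le> s'" for s s'
  proof -
    have "(2::nat) ^ s' = 2 ^ s * 2 ^ (s' - s)" using that by (simp flip: power_add)
    then have "spow a (2 ^ s' * t) = spow (spow a (2 ^ s * t)) (2 ^ (s' - s))"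
      using pos by (subst spow_mult) (auto simp: algebra_simps)
    then show ?thesis unfolding mem_sgen_singleton by (meson one_le_numeral one_le_power)
  qed
  have mixed: "monogenic (sgen {u, v})"
    if u: "u = spow a (2 ^ s * t)" "2 ^ s * t < sindex a"
      and v: "v \<in> sgen {spow a (2 ^ s' * t)}" "sindex a \<le> 2 * (2 ^ s' * t)" for u v s s'
  proof -
    have "2 ^ s * t < 2 ^ Suc s' * t" using u v by (simp only: power_Suc mult.assoc)
    then have "(2::nat) ^ s < 2 ^ Suc s'" by (simp only: mult_less_cancel2)
    then have "s \<le> s'" by (simp only: power_strict_increasing_iff less_Suc_eq_le one_less_numeral_iff
      semiring_norm)
    then have "v \<in> sgen {u}" using power u v sgen_singleton_subset_iff by blast
    then show ?thesis by (rule monogenic_pair_power)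
  qed
  from assms(2,3) consider
      (both_below) s s' where "x = spow a (2 ^ s * t)" "y = spow a (2 ^ s' * t)"
    | (first_below) s s' where "x = spow a (2 ^ s * t)" "2 ^ s * t < sindex a"
        "y \<in> sgen {spow a (2 ^ s' * t)}" "sindex a \<le> 2 * (2 ^ s' * t)"
    | (second_below) s s' where "y = spow a (2 ^ s * t)" "2 ^ s * t < sindex a"
        "x \<in> sgen {spow a (2 ^ s' * t)}" "sindex a \<le> 2 * (2 ^ s' * t)"
    | (index_1) s s' where "sindex x = 1" "sindex y = 1"
        "x \<in> sgen {spow a (2 ^ s * t)}" "y \<in> sgen {spow a (2 ^ s' * t)}"
    unfolding z charged.simps by blast
  then show ?thesis
  proof cases
    case both_below
    then show ?thesis
      using power[of s s'] power[of s' s] monogenic_pair_power[of y x] monogenic_pair_power[of x y]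
      by (metis insert_commute nat_le_linear)
  next
    case first_below
    then show ?thesis by (rule mixed)
  next
    case second_below
    then have "monogenic (sgen {y, x})" by (rule mixed)
    then show ?thesis by (simp add: insert_commute)
  next
    case index_1
    then show ?thesis using in_a monogenic_pair_index_1[of x a y] by blast
  qed
qed

lemma card_odd_less: "card {t::nat. odd t \<and> t < m} = m div 2"
proof -
  have "{t::nat. odd t \<and> t < m} = (\<lambda>k. 2 * k + 1) ` {..<m div 2}"
    by (auto simp: image_iff elim!: oddE)
  moreover have "inj_on (\<lambda>k::nat. 2 * k + 1) {..<m div 2}" by (simp add: inj_on_def)
  ultimately show ?thesis by (simp add: card_image)
qed

lemma card_tokens:
  assumes "finite (M_set :: 'a set)" "finite (J2 X)"
  shows "finite (tokens (X :: 'a set))"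
    and "card (tokens X) = card (J2 X) + (\<Sum>a\<in>(M_set :: 'a set). sindex a div 2)"
proof -
  have fin: "finite {t::nat. odd t \<and> t < m}" for m by simp
  show "finite (tokens X)" unfolding tokens_def using assms fin by (intro finite_Plus finite_SigmaI)
  show "card (tokens X) = card (J2 X) + (\<Sum>a\<in>(M_set :: 'a set). sindex a div 2)"
    unfolding tokens_def using assms fin
    by (subst card_Plus) (auto simp: card_SigmaI card_odd_less)
qed

lemma independent_set_ecard_le:
  assumes "representatives tau (X :: 'a set)" "finite (M_set :: 'a set)"
    and "independent_set UNIV cyclic_graph (A :: 'a set)"
  shows "ecard A \<le> ecard (J2 X) + enat (\<Sum>a\<in>(M_set :: 'a set). sindex a div 2)"
proof (cases "finite (J2 X)")
  case True
  have "\<forall>x. \<exists>z. z \<in> tokens X \<and> charged (x::'a) z" using exists_token[OF assms(1)] by blast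
  then obtain f where f: "\<And>x::'a. f x \<in> tokens X \<and> charged x (f x)" by metis
  have "inj_on f A"
  proof (rule inj_onI, rule ccontr)
    fix x y assume xy: "x \<in> A" "y \<in> A" "f x = f y" "x \<noteq> y"
    then have "monogenic (sgen {x, y})" using same_token_adjacent[of "f x" X x y] f by metis
    then show False using assms(3) xy by (auto simp: independent_set_def cyclic_graph_def)
  qed
  moreover have "f ` A \<subseteq> tokens X" using f by blast
  ultimately have "finite A" "card A \<le> card (tokens X)"
    using inj_on_finite[OF _ _ card_tokens(1)[OF assms(2) True]]
      card_inj_on_le[OF _ _ card_tokens(1)[OF assms(2) True]] by metis+
  then show ?thesis using True card_tokens[OF assms(2) True] by (simp add: ecard_def)
qed (simp add: ecard_def)

end

lemma ecard_Un_disjoint: "A \<inter> B = {} \<Longrightarrow> ecard (A \<union> B) = ecard A + ecard B"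
  by (auto simp: ecard_def card_Un_disjoint)

theorem theorem5p3:
  fixes n :: nat and X :: "'a::semigroup_mult set"
  assumes "bounded_exponent TYPE('a)"
    and "n = sexponent TYPE('a)"
    and "finite (M_set :: 'a set)"
    and "representatives tau X"
  shows "ecard (I2 :: 'a set) + ecard (J2 X)
           \<le> independence_number (UNIV :: 'a set) cyclic_graph
       \<and> independence_number (UNIV :: 'a set) cyclic_graph
           \<le> ecard (J2 X) + enat (\<Sum>a\<in>(M_set :: 'a set). sindex a div 2)"
proof -
  have "\<exists>n. n \<ge> 1 \<and> (\<forall>x::'a. idempotent (spow x n))"
    using assms(1) by (auto simp: bounded_exponent_def)
  then have "n \<ge> 1 \<and> (\<forall>x::'a. idempotent (spow x n))"
    unfolding assms(2) sexponent_def by (rule LeastI_ex)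
  then interpret periodic_semigroup n "TYPE('a)" by unfold_locales auto
  have "(I2 :: 'a set) \<inter> J2 X = {}"
    using sindex_M_bar by (force simp: I2_def J2_def)
  then have "ecard (I2 :: 'a set) + ecard (J2 X) = ecard (I2 \<union> J2 X)"
    by (rule ecard_Un_disjoint[symmetric])
  also have "\<dots> \<le> independence_number (UNIV :: 'a set) cyclic_graph"
    unfolding independence_number_def by (rule SUP_upper) (simp add: independent_I2_J2[OF assms(4)])
  finally show ?thesis
    unfolding independence_number_def
    using independent_set_ecard_le[OF assms(4,3)] by (auto intro: SUP_least)
qed

end
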